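(* Let $\mathbb{F}_q$ be a finite field of characteristic different from $2$, let $f(x)\in\mathbb{F}_q[x]$ be an irreducible polynomial of degree $d$, and let $N: y^2=xf(x)^2$ be the corresponding nodal curve over $\mathbb{F}_q$. Then any divisor class $D\in \mathrm{Jac}(N)$ is uniquely represented by a polynomial $h(x)\in\mathbb{F}_q[x]$ satisfying $$\deg(h(x))<d\quad\text{and}\quad \gcd\bigl(f(x),\,x-h(x)^2\bigr)=1,$$ where $h(x)$ represents the class $[f(x)^2,\,h(x)f(x)]$.
   Context: A nodal curve here means a curve $N: y^2=xf(x)^2$ over $\mathbb{F}_q$ (characteristic $\neq 2$) with $f(x)\in\mathbb{F}_q[x]$ irreducible. Its (generalized) Jacobian $\mathrm{Jac}(N)$ is the ideal class group of the coordinate ring $A=\mathbb{F}_q[x,y]/(y^2-xf(x)^2)$, i.e. the group of invertible fractional ideals of $A$ modulo principal ones, written additively. Mumford representation: a pair of polynomials $[u(x),v(x)]$ in $\mathbb{F}_q[x]$ represents an element of $\mathrm{Jac}(N)$ if (1) $\deg v<\deg u$; (2) $u(x)$ divides $v(x)^2-xf(x)^2$; (3) whenever $(a,0)$ is a singular point of $N$ (i.e. $a$ in the algebraic closure of $\mathbb{F}_q$ is a multiple root of $xf(x)^2$) and $x-a$ divides both $u(x)$ and $v(x)$, then $x-a$ does not divide $\dfrac{xf(x)^2-v(x)^2}{u(x)}$. The element represented by $[u(x),v(x)]$ is the class of the ideal of $A$ generated by $u(x)$ and $y-v(x)$, and is also denoted $[u(x),v(x)]$. The identity element is represented by $[1,0]$.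 The zero polynomial is regarded as having degree less than any non-negative integer.
   Formalization: The identity class is excepted: it is represented by [1,0] and by no such h(x), so the claim as stated fails for it (q=3, f=x-1: two classes, but only h=0 is allowed). Every other divisor class is proved to be uniquely represented. *)

theory Defs
  imports
    "HOL-Algebra.Algebraic_Closure_Type"
    "HOL-Algebra.QuotRing"
    "HOL-Algebra.Ideal_Product"
begin

section \<open>The field of fractions of a domain\<close>

definition fract_rel :: "('a, 'm) ring_scheme \<Rightarrow> (('a \<times> 'a) \<times> ('a \<times> 'a)) set" where
  "fract_rel R =
     {((a, b), (c, d)). a \<in> carrier R \<and> b \<in> carrier R - {\<zero>\<^bsub>R\<^esub>} \<and>
                        c \<in> carrier R \<and> d \<in> carrier R - {\<zero>\<^bsub>R\<^esub>} \<and>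
                        a \<otimes>\<^bsub>R\<^esub> d = c \<otimes>\<^bsub>R\<^esub> b}"

definition fraction :: "('a, 'm) ring_scheme \<Rightarrow> 'a \<Rightarrow> 'a \<Rightarrow> ('a \<times> 'a) set" where
  "fraction R a b = fract_rel R `` {(a, b)}"

definition fraction_field :: "('a, 'm) ring_scheme \<Rightarrow> ('a \<times> 'a) set ring" where
  "fraction_field R =
     \<lparr>carrier = (carrier R \<times> (carrier R - {\<zero>\<^bsub>R\<^esub>})) // fract_rel R,
      monoid.mult = (\<lambda>S T. \<Union>p\<in>S. \<Union>q\<in>T.
               fraction R (fst p \<otimes>\<^bsub>R\<^esub> fst q) (snd p \<otimes>\<^bsub>R\<^esub> snd q)),
      one = fraction R \<one>\<^bsub>R\<^esub> \<one>\<^bsub>R\<^esub>,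
      ring.zero = fraction R \<zero>\<^bsub>R\<^esub> \<one>\<^bsub>R\<^esub>,
      add = (\<lambda>S T. \<Union>p\<in>S. \<Union>q\<in>T.
               fraction R (fst p \<otimes>\<^bsub>R\<^esub> snd q \<oplus>\<^bsub>R\<^esub> fst q \<otimes>\<^bsub>R\<^esub> snd p) (snd p \<otimes>\<^bsub>R\<^esub> snd q))\<rparr>"

definition to_fraction :: "('a, 'm) ring_scheme \<Rightarrow> 'a \<Rightarrow> ('a \<times> 'a) set" where
  "to_fraction R r = fraction R r \<one>\<^bsub>R\<^esub>"


section \<open>The ideal class group of a domain\<close>

definition fractional_ideal :: "('a, 'm) ring_scheme \<Rightarrow> ('a \<times> 'a) set set \<Rightarrow> bool" where
  "fractional_ideal R I \<longleftrightarrow>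
     additive_subgroup I (fraction_field R) \<and>
     (\<forall>r\<in>carrier R. \<forall>x\<in>I. to_fraction R r \<otimes>\<^bsub>fraction_field R\<^esub> x \<in> I) \<and>
     (\<exists>s\<in>carrier R - {\<zero>\<^bsub>R\<^esub>}. \<forall>x\<in>I.
        to_fraction R s \<otimes>\<^bsub>fraction_field R\<^esub> x \<in> to_fraction R ` carrier R)"

definition invertible_ideals :: "('a, 'm) ring_scheme \<Rightarrow> ('a \<times> 'a) set set monoid" where
  "invertible_ideals R =
     \<lparr>carrier = {I. fractional_ideal R I \<and>
                    (\<exists>J. fractional_ideal R J \<and>
                         ideal_prod (fraction_field R) I J = to_fraction R ` carrier R)},
      monoid.mult = ideal_prod (fraction_field R),
      one = to_fraction R ` carrier R\<rparr>"

definition principal_ideals :: "('a, 'm) ring_scheme \<Rightarrow> ('a \<times> 'a) set set set" where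
  "principal_ideals R =
     {(\<lambda>r. g \<otimes>\<^bsub>fraction_field R\<^esub> to_fraction R r) ` carrier R | g.
        g \<in> carrier (fraction_field R) - {\<zero>\<^bsub>fraction_field R\<^esub>}}"

definition ideal_class_group :: "('a, 'm) ring_scheme \<Rightarrow> ('a \<times> 'a) set set set monoid" where
  "ideal_class_group R = invertible_ideals R Mod principal_ideals R"


section \<open>The curve \<open>y\<^sup>2 = x f(x)\<^sup>2\<close> and its generalized Jacobian\<close>

text \<open>
  The ring \<open>F[x,y]\<close> is represented by the type \<open>'a poly poly\<close>: the inner variable is \<open>x\<close>, the
  outer one is \<open>y\<close>. Thus \<open>[:u:]\<close> is the polynomial \<open>u(x)\<close> and \<open>[:- v, 1:]\<close> is \<open>y - v(x)\<close>.
\<close>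

definition curve_poly :: "'a::field poly \<Rightarrow> 'a poly" where
  "curve_poly f = [:0, 1:] * f ^ 2"

definition curve_ideal :: "'a::field poly \<Rightarrow> 'a poly poly set" where
  "curve_ideal f = genideal ring_of_type_algebra {[:0, 1:] ^ 2 - [:curve_poly f:]}"

definition coord_ring :: "'a::field poly \<Rightarrow> 'a poly poly set ring" where
  "coord_ring f = ring_of_type_algebra Quot curve_ideal f"

definition to_coord_ring :: "'a::field poly \<Rightarrow> 'a poly poly \<Rightarrow> 'a poly poly set" where
  "to_coord_ring f p = curve_ideal f +>\<^bsub>ring_of_type_algebra\<^esub> p"

text \<open>The Jacobian is written multiplicatively here: its identity element is \<open>\<one>\<^bsub>Jac f\<^esub>\<close>.\<close>

definition Jac ::
  "'a::field poly \<Rightarrow> ('a poly poly set \<times> 'a poly poly set) set set set monoid" where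
  "Jac f = ideal_class_group (coord_ring f)"


section \<open>Mumford representation\<close>

text \<open>\<open>Polynomial.degree 0 = 0\<close>; here, the degree of \<open>0\<close> is below every natural number.\<close>

definition degree_below :: "'a::zero poly \<Rightarrow> nat \<Rightarrow> bool" where
  "degree_below p n \<longleftrightarrow> p = 0 \<or> Polynomial.degree p < n"

text \<open>In the first condition, \<open>u \<noteq> 0\<close> is needed since no degree is below that of \<open>0\<close>.\<close>

definition mumford_pair :: "'a::field poly \<Rightarrow> 'a poly \<Rightarrow> 'a poly \<Rightarrow> bool" where
  "mumford_pair f u v \<longleftrightarrow>
     (u \<noteq> 0 \<and> degree_below v (Polynomial.degree u)) \<and>
     u dvd v ^ 2 - curve_poly f \<and>
     (\<forall>a :: 'a alg_closure.
        Polynomial.order a (map_poly to_ac (curve_poly f)) \<ge> 2 \<and>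
        [:- a, 1:] dvd map_poly to_ac u \<and> [:- a, 1:] dvd map_poly to_ac v \<longrightarrow>
        \<not> [:- a, 1:] dvd map_poly to_ac ((curve_poly f - v ^ 2) div u))"

definition mumford_ideal :: "'a::field poly \<Rightarrow> 'a poly \<Rightarrow> 'a poly \<Rightarrow> 'a poly poly set set" where
  "mumford_ideal f u v =
     genideal (coord_ring f) {to_coord_ring f [:u:], to_coord_ring f [:- v, 1:]}"

definition mumford_class ::
  "'a::field poly \<Rightarrow> 'a poly \<Rightarrow> 'a poly \<Rightarrow>
     ('a poly poly set \<times> 'a poly poly set) set set set" where
  "mumford_class f u v =
     principal_ideals (coord_ring f) #>\<^bsub>invertible_ideals (coord_ring f)\<^esub>
       (to_fraction (coord_ring f) ` mumford_ideal f u v)"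

definition mumford_represents ::
  "'a::field poly \<Rightarrow> 'a poly \<Rightarrow> 'a poly \<Rightarrow>
     ('a poly poly set \<times> 'a poly poly set) set set set \<Rightarrow> bool" where
  "mumford_represents f u v D \<longleftrightarrow> mumford_pair f u v \<and> mumford_class f u v = D"

definition represents ::
  "'a::field poly \<Rightarrow> 'a poly \<Rightarrow>
     ('a poly poly set \<times> 'a poly poly set) set set set \<Rightarrow> bool" where
  "represents f h D \<longleftrightarrow> mumford_represents f (f ^ 2) (h * f) D"

end

theory Submission
  imports Defs
begin

text \<open>
  With \<open>t = y / f\<close>, so that \<open>t\<^sup>2 = x\<close>, the function field of the curve is \<open>F(t)\<close>, the normalization of
  the coordinate ring is \<open>F[t]\<close>, and the coordinate ring is \<open>A = {a + b t | f divides b}\<close>, with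
  conductor \<open>f F[t]\<close>. An invertible fractional ideal \<open>I\<close> can be scaled so that \<open>I F[t] = F[t]\<close>. Then
  \<open>f F[t] \<subseteq> I \<subseteq> F[t]\<close>, and \<open>I / f F[t]\<close> is a subspace of the plane \<open>F[t] / f F[t]\<close> over \<open>F[x] / (f)\<close>. It is
  not \<open>0\<close>, and it is not the whole plane, because \<open>F[t]\<close> is not an invertible \<open>A\<close>-module. So it is a
  line: either that of \<open>1\<close>, giving \<open>I = A\<close>, or that of \<open>t - h\<close> for a unique \<open>h\<close> modulo \<open>f\<close>, and then
  \<open>I F[t] = F[t]\<close> forces \<open>h\<^sup>2 - x\<close> to be prime to \<open>f\<close>. In the latter case \<open>f I\<close> is the ideal generated by
  \<open>f\<^sup>2\<close> and \<open>y - h f\<close>. The scaling is unique up to units of \<open>F[t]\<close>, which are constants.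
\<close>

section \<open>Modules between the conductor and the normalization\<close>

lemma poly_ideal_principal:
  fixes S :: "'a::field poly set"
  assumes "0 \<in> S" "\<And>x y. x \<in> S \<Longrightarrow> y \<in> S \<Longrightarrow> x + y \<in> S" "\<And>a x. x \<in> S \<Longrightarrow> a * x \<in> S"
  obtains g where "S = range ((*) g)"
proof (cases "S = {0}")
  case True
  then have "S = range ((*) 0)" by auto
  then show ?thesis by (rule that)
next
  case False
  then obtain p where "p \<in> S" "p \<noteq> 0" using assms(1) by blast
  \<comment> \<open>A nonzero element of least degree: remainders modulo it stay in
    \<open>S\<close>, so they vanish.\<close>
  then obtain g where g: "g \<in> S" "g \<noteq> 0"
    and min: "\<And>q. q \<in> S \<Longrightarrow> q \<noteq> 0 \<Longrightarrow> Polynomial.degree g \<le> Polynomial.degree q"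
    using exists_least_lemma ex_has_least_nat[of "\<lambda>q. q \<in> S \<and> q \<noteq> 0" p Polynomial.degree] by metis
  have "g dvd q" if "q \<in> S" for q
  proof -
    have "q mod g = q + (- (q div g)) * g"
      by (metis minus_div_mult_eq_mod diff_conv_add_uminus mult_minus_left)
    then have "q mod g \<in> S" using assms g that by metis
    then have "q mod g = 0" using min degree_mod_less[OF g(2), of q] by force
    then show ?thesis by auto
  qed
  then have "S = range ((*) g)" using assms(3)[OF g(1)] by (auto simp: dvd_def mult.commute)
  then show ?thesis by (rule that)
qed

lemma poly_coprime_bezout:
  fixes p q :: "'a::field poly"
  assumes "coprime p q"
  obtains r s where "r * p + s * q = 1"
proof -
  define S where "S = {r * p + s * q | r s. True}"
  have S: "r * p + s * q \<in> S" for r s by (auto simp: S_def)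
  obtain g where g: "S = range ((*) g)"
  proof (rule poly_ideal_principal[of S])
    show "0 \<in> S" using S[of 0 0] by simp
  next
    fix x y assume "x \<in> S" "y \<in> S"
    then obtain r s r' s' where "x = r * p + s * q" "y = r' * p + s' * q" by (auto simp: S_def)
    then have "x + y = (r + r') * p + (s + s') * q" by (simp add: distrib_right)
    then show "x + y \<in> S" using S by simp
  next
    fix a x assume "x \<in> S"
    then obtain r s where "x = r * p + s * q" by (auto simp: S_def)
    then have "a * x = (a * r) * p + (a * s) * q" by (simp add: distrib_left mult.assoc)
    then show "a * x \<in> S" using S by simp
  qed
  have "p \<in> S" "q \<in> S" using S[of 1 0] S[of 0 1] by simp_all
  then have "g dvd p" "g dvd q" unfolding g by auto
  then have "is_unit g" using assms coprime_common_divisor by blast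
  then have "1 \<in> S" unfolding g by (auto simp: dvd_def)
  then obtain r s where "1 = r * p + s * q" by (auto simp: S_def)
  then show ?thesis using that by metis
qed

lemma poly_irreducible_coprime:
  fixes f :: "'a::field poly"
  assumes "Factorial_Ring.irreducible f" "\<not> f dvd e"
  shows "coprime f e"
proof (rule coprimeI)
  fix c assume c: "c dvd f" "c dvd e"
  then obtain k where k: "f = c * k" by blast
  then consider "is_unit c" | "is_unit k" using assms(1) by (auto simp: Factorial_Ring.irreducible_def)
  then show "is_unit c"
  proof cases
    case 2
    then show ?thesis using k c(2) assms(2) by (metis mult_unit_dvd_iff)
  qed
qed

section \<open>F[t] as a free module over F[x] with basis 1, t\<close>

text \<open>Elements of \<open>F[t]\<close> are polynomials of type \<open>'a poly\<close> in \<open>t\<close>; \<open>par a b\<close> is \<open>a(x) + b(x) t\<close> for \<open>x = t\<^sup>2\<close>.\<close>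

definition par :: "'a::field poly \<Rightarrow> 'a poly \<Rightarrow> 'a poly" where
  "par a b = pcompose a [:0, 0, 1:] + [:0, 1:] * pcompose b [:0, 0, 1:]"

lemma par_add: "par a b + par c d = par (a + c) (b + d)"
  by (simp add: par_def pcompose_add algebra_simps)

lemma par_mult: "par a b * par c d = par (a * c + [:0, 1:] * b * d) (a * d + b * c)"
proof -
  \<comment> \<open>x becomes t * t, which moves the product of the two odd parts into the even
    part.\<close>
  have X: "pcompose [:0, 1:] [:0, 0, 1:] = [:0, 1:] * [:0, 1 :: 'a:]"
    by (simp add: pcompose_pCons)
  show ?thesis
    by (simp only: par_def pcompose_add pcompose_mult X ring_distribs mult.assoc mult.left_commute add.assoc add.left_commute add.commute mult.commute)
qed

lemma par_exhaust: obtains a b where "p = par a b"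
proof -
  have "\<exists>a b. p = par a b"
  proof (induction p)
    case 0
    show ?case by (rule exI[of _ 0], rule exI[of _ 0]) (simp add: par_def)
  next
    case (pCons c p)
    then obtain a b where "p = par a b" by blast
    then have "pCons c p = par ([:c:] + [:0, 1:] * b) a"
      by (simp add: par_def pcompose_add pcompose_mult pcompose_pCons algebra_simps)
    then show ?case by blast
  qed
  then show ?thesis using that by blast
qed

lemma par_set_eqI:
  assumes "\<And>a b. par a b \<in> S \<longleftrightarrow> par a b \<in> T"
  shows "S = T"
proof (rule Set.set_eqI)
  fix p show "p \<in> S \<longleftrightarrow> p \<in> T" by (rule par_exhaust[of p]) (simp add: assms)
qed

text \<open>A nonzero a(t^2) has even degree in t and a nonzero t b(t^2) has odd degree, so the two
  cannot cancel.\<close>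

lemma par_eq_0_iff: "par a b = 0 \<longleftrightarrow> a = 0 \<and> b = 0"
proof
  let ?E = "\<lambda>p. pcompose p [:0, 0, 1 :: 'a:]"
  assume *: "par a b = 0"
  have E0: "?E p = 0 \<longleftrightarrow> p = 0" for p
    by (simp add: pcompose_eq_0_iff)
  have ev: "Polynomial.degree (?E p) = 2 * Polynomial.degree p" for p
    by (simp add: degree_pcompose)
  show "a = 0 \<and> b = 0"
  proof (cases "b = 0")
    case True
    then show ?thesis using * E0[of a] by (simp add: par_def)
  next
    case False
    then have "Polynomial.degree ([:0, 1:] * ?E b) = Suc (2 * Polynomial.degree b)"
      using E0[of b] by (simp add: degree_mult_eq ev)
    moreover have "?E a = - ([:0, 1:] * ?E b)"
      using * unfolding par_def by (rule eq_neg_iff_add_eq_0[THEN iffD2])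
    \<comment> \<open>Contradiction by parity; the case \<open>a = 0\<close> is included, since its
      degree is 0.\<close>
    ultimately have "2 * Polynomial.degree a = Suc (2 * Polynomial.degree b)"
      by (metis ev degree_minus)
    then show ?thesis by presburger
  qed
qed (simp add: par_def)

lemma par_eq_iff [simp]: "par a b = par c d \<longleftrightarrow> a = c \<and> b = d"
proof -
  have "par a b = par c d \<longleftrightarrow> par (a - c) (b - d) = 0"
    unfolding par_def pcompose_diff right_diff_distrib
    by (auto simp: algebra_simps simp del: mult_pCons_left)
  then show ?thesis by (simp add: par_eq_0_iff)
qed

lemma par_0 [simp]: "par 0 0 = 0" by (simp add: par_def)
lemma par_1: "par 1 0 = 1" by (simp add: par_def pcompose_1)
lemma par_const: "[:c:] = par [:c:] 0" by (simp add: par_def)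

lemma par_t: "[:0, 1:] = par 0 1" by (simp add: par_def pcompose_1)

section \<open>The coordinate ring F[x] + f t F[x] and the lattices between f F[t] and F[t]\<close>

definition nodal_order :: "'a::field poly \<Rightarrow> 'a poly set" where
  "nodal_order f = {par a b | a b. f dvd b}"

text \<open>Since a + b t = (a + h b) + b (t - h), this is the preimage in F[t] of the line spanned
  by t - h modulo f.\<close>

definition nodal_lattice :: "'a::field poly \<Rightarrow> 'a poly \<Rightarrow> 'a poly set" where
  "nodal_lattice f h = {par a b | a b. f dvd a + h * b}"

lemma par_in_order [simp]: "par a b \<in> nodal_order f \<longleftrightarrow> f dvd b"
  by (auto simp: nodal_order_def)

lemma par_in_lattice [simp]: "par a b \<in> nodal_lattice f h \<longleftrightarrow> f dvd a + h * b"
  by (auto simp: nodal_lattice_def)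

text \<open>Polymorphic, so that it applies both inside F[t] and inside its field of
  fractions.\<close>

definition submodule_of :: "'b::comm_ring_1 set \<Rightarrow> 'b set \<Rightarrow> bool" where
  "submodule_of A N \<longleftrightarrow>
     0 \<in> N \<and> (\<forall>x\<in>N. \<forall>y\<in>N. x + y \<in> N) \<and> (\<forall>a\<in>A. \<forall>x\<in>N. a * x \<in> N)"

lemma submodule_order: "submodule_of (nodal_order f) (nodal_order f)"
  unfolding submodule_of_def
proof (intro conjI ballI)
  show "0 \<in> nodal_order f" by (metis par_0 par_in_order dvd_0_right)
  fix x y assume "x \<in> nodal_order f" "y \<in> nodal_order f"
  then show "x + y \<in> nodal_order f" "x * y \<in> nodal_order f"
    by (auto simp: nodal_order_def[of f] par_add par_mult simp del: par_eq_iff)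
       (metis dvd_add dvd_mult dvd_mult2)+
qed

lemma submodule_lattice: "submodule_of (nodal_order f) (nodal_lattice f h)"
  unfolding submodule_of_def
proof (intro conjI ballI)
  show "0 \<in> nodal_lattice f h" by (metis par_0 par_in_lattice add_0 mult_zero_right dvd_0_right)
next
  fix x y assume x: "x \<in> nodal_lattice f h" and y: "y \<in> nodal_lattice f h"
  obtain a b c d where [simp]: "x = par a b" "y = par c d" by (metis par_exhaust)
  have "f dvd (a + h * b) + (c + h * d)" using x y by (intro dvd_add[of f "a + h * b"]) auto
  then show "x + y \<in> nodal_lattice f h" by (simp add: par_add algebra_simps)
next
  fix x y assume x: "x \<in> nodal_order f" and y: "y \<in> nodal_lattice f h"
  obtain a b c d where [simp]: "x = par a b" "y = par c d" by (metis par_exhaust)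
  \<comment> \<open>The lattice condition for the product, regrouped: f divides the first term
    because \<open>y\<close> lies in the lattice, the second because f divides
    \<open>b\<close>.\<close>
  have "f dvd a * (c + h * d) + b * ([:0, 1:] * d + h * c)"
    using x y by (intro dvd_add[of f "a * (c + h * d)"]) auto
  then show "x * y \<in> nodal_lattice f h" by (simp add: par_mult algebra_simps)
qed

text \<open>\<open>full\<close> puts 1 into N + t N, which forces N to contain the conductor f F[t];
  \<open>z\<close> says that N is not stable under t, which excludes F[t]. What is left modulo f is
  a line over the field F[x]/(f), either that of 1 or that of some t - h.\<close>

lemma lattice_classification:
  fixes N :: "'a::field poly set"
  assumes irr: "Factorial_Ring.irreducible f"
    and sub: "submodule_of (nodal_order f) N"
    and full: "u \<in> N" "w \<in> N" "1 = u + [:0, 1:] * w"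
    and z: "z \<in> N" "[:0, 1:] * z \<notin> N"
  shows "N = nodal_order f \<or>
    (\<exists>h. degree_below h (Polynomial.degree f) \<and> coprime f ([:0, 1:] - h ^ 2) \<and> N = nodal_lattice f h)"
proof -
  have N0: "0 \<in> N" and Nadd: "\<And>x y. x \<in> N \<Longrightarrow> y \<in> N \<Longrightarrow> x + y \<in> N"
    and Nmul: "\<And>a x. a \<in> nodal_order f \<Longrightarrow> x \<in> N \<Longrightarrow> a * x \<in> N"
    using sub by (auto simp: submodule_of_def)
  have f: "f \<noteq> 0" "\<not> is_unit f" using irr by (auto simp: Factorial_Ring.irreducible_def)
  \<comment> \<open>For c in f F[t] both c and t c lie in the order, so c = c u + (c t) w lies in
    \<open>N\<close>.\<close>
  have cond: "par (f * a) (f * b) \<in> N" for a b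
  proof -
    have *: "par (f * a) (f * b) = par (f * a) (f * b) * u + (par (f * a) (f * b) * [:0, 1:]) * w"
      using full(3) by (metis distrib_left mult.assoc mult.right_neutral)
    show ?thesis
      by (subst *, intro Nadd Nmul full) (auto simp: par_t par_mult)
  qed
  have lin: "par (p * a + f * r) (p * b + f * s) \<in> N" if "par a b \<in> N" for p a b r s
  proof -
    have "par p 0 * par a b + par (f * r) (f * s) \<in> N"
      by (intro Nadd Nmul that cond) auto
    then show ?thesis by (simp add: par_mult par_add)
  qed
  \<comment> \<open>Computation modulo f: the difference from a multiple of \<open>par a b\<close>
    lies in the conductor.\<close>
  have lin': "par c d \<in> N" if "par a b \<in> N" "f dvd c - p * a" "f dvd d - p * b" for p a b c d
  proof -
    from that obtain r s where "c = p * a + f * r" "d = p * b + f * s"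
      by (auto simp: dvd_def algebra_simps)
    then show ?thesis using lin[OF that(1), of p r s] by simp
  qed
  \<comment> \<open>1 and t generate F[t] over F[x], but \<open>N\<close> does not contain t
    z.\<close>
  have notfull: False if "par 1 0 \<in> N" "par 0 1 \<in> N"
  proof -
    obtain a b where "[:0, 1:] * z = par a b" by (rule par_exhaust)
    moreover have "par a b = par a 0 * par 1 0 + par b 0 * par 0 1" by (simp add: par_mult par_add)
    ultimately show False using z(2) Nadd Nmul that by (metis par_in_order dvd_0_right)
  qed
  have inv: "\<exists>m. f dvd m * e - 1" if "\<not> f dvd e" for e
  proof -
    have "coprime f e" using irr that by (rule poly_irreducible_coprime)
    then obtain r s where "s * f + r * e = 1" by (rule poly_coprime_bezout)
    then have "r * e - 1 = f * (- s)" by (simp add: algebra_simps)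
    then show ?thesis by (metis dvd_triv_left)
  qed
  \<comment> \<open>Cramer's rule: if the determinant were invertible modulo f, then modulo f both 1
    and t would be combinations of the two members.\<close>
  have det: "f dvd a * d - b * c" if ab: "par a b \<in> N" and cd: "par c d \<in> N" for a b c d
  proof (rule ccontr)
    assume "\<not> ?thesis"
    then obtain m where m: "f dvd m * (a * d - b * c) - 1" using inv by blast
    have "par (m * d) 0 * par a b + par (- (m * b)) 0 * par c d \<in> N"
      by (intro Nadd Nmul ab cd) auto
    then have 1: "par (m * (a * d - b * c)) 0 \<in> N" by (simp add: par_mult par_add algebra_simps)
    have "par (- (m * c)) 0 * par a b + par (m * a) 0 * par c d \<in> N"
      by (intro Nadd Nmul ab cd) auto
    then have 2: "par 0 (m * (a * d - b * c)) \<in> N" by (simp add: par_mult par_add algebra_simps)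
    have m': "f dvd 1 - m * (a * d - b * c)" using m by (metis dvd_minus_iff minus_diff_eq)
    show False
      using notfull lin'[OF 1, of 1 1 0] lin'[OF 2, of 0 1 1] m' by simp
  qed
  \<comment> \<open>One of \<open>u\<close> and \<open>w\<close> is nonzero modulo f: the first
    coordinates in u + t w = 1 give 1 = a + x d, and f is not a unit.\<close>
  obtain a b where ab: "par a b \<in> N" "\<not> (f dvd a \<and> f dvd b)"
  proof -
    obtain a b where u: "u = par a b" by (rule par_exhaust)
    obtain c d where w: "w = par c d" by (rule par_exhaust)
    have "par 1 0 = u + [:0, 1:] * w" using full(3) by (simp add: par_1)
    then have "1 = a + [:0, 1:] * d" by (simp add: u w par_t par_mult par_add)
    then have "\<not> (f dvd a \<and> f dvd d)" using f(2) by (metis dvd_add dvd_mult)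
    then show ?thesis using that full u w by blast
  qed
  show ?thesis
  proof (cases "f dvd b")
    case True
    then obtain m where m: "f dvd m * a - 1" using ab inv by blast
    \<comment> \<open>Modulo f, \<open>b\<close> is 0 and \<open>a\<close> is invertible, so the
      line is that of 1.\<close>
    have "par c d \<in> N \<longleftrightarrow> f dvd d" for c d
    proof
      assume "par c d \<in> N"
      then have "f dvd m * (a * d - b * c)" using det[OF ab(1)] by simp
      moreover have "f dvd b * (m * c)" "f dvd d * (m * a - 1)" using True m by simp_all
      ultimately have "f dvd m * (a * d - b * c) + b * (m * c) - d * (m * a - 1)"
        by (intro dvd_diff dvd_add)
      then show "f dvd d" by (simp add: algebra_simps)
    next
      assume d: "f dvd d"
      from m have "f dvd c * (1 - m * a)" by (metis dvd_minus_iff minus_diff_eq dvd_mult)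
      then show "par c d \<in> N"
        using True d by (intro lin'[OF ab(1), where p = "c * m"]) (auto simp: algebra_simps)
    qed
    then have "N = nodal_order f" by (intro par_set_eqI) simp
    then show ?thesis ..
  next
    case False
    then obtain m where m: "f dvd m * b - 1" using inv by blast
    \<comment> \<open>With \<open>m\<close> inverse to \<open>b\<close> modulo f, m (a + b t) is
      congruent to t + m a, so - m a is the h in t - h; taking the remainder gives the degree
      bound.\<close>
    define h where "h = (- (m * a)) mod f"
    have h: "f dvd h + m * a"
    proof -
      have "f dvd (- (m * a)) - h" unfolding h_def by (rule dvd_minus_mod)
      then show ?thesis by (metis dvd_minus_iff minus_diff_eq diff_minus_eq_add)
    qed
    have deg: "degree_below h (Polynomial.degree f)"
      unfolding degree_below_def h_def using degree_mod_less[OF f(1)] by blast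
    have mem: "par (- h) 1 \<in> N"
    proof (rule lin'[OF ab(1), where p = m])
      have "- h - m * a = - (h + m * a)" by simp
      then show "f dvd - h - m * a" using h by (metis dvd_minus_iff)
      show "f dvd 1 - m * b" using m by (metis dvd_minus_iff minus_diff_eq)
    qed
    have iff: "par c d \<in> N \<longleftrightarrow> f dvd c + h * d" for c d
    proof
      assume "par c d \<in> N"
      from det[OF mem this] have "f dvd - h * d - 1 * c" .
      also have "- h * d - 1 * c = - (c + h * d)" by simp
      finally have "f dvd - (c + h * d)" .
      then show "f dvd c + h * d" by (metis dvd_minus_iff)
    next
      assume "f dvd c + h * d"
      then show "par c d \<in> N" by (intro lin'[OF mem, where p = d]) (auto simp: algebra_simps)
    qed
    then have N: "N = nodal_lattice f h" by (intro par_set_eqI) simp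
    \<comment> \<open>If x = h^2 modulo f, then t (t - h) = - h (t - h) modulo f, and
      \<open>N\<close> would be stable under t.\<close>
    have "\<not> f dvd [:0, 1:] - h ^ 2"
    proof
      assume *: "f dvd [:0, 1:] - h ^ 2"
      obtain c d where zc: "z = par c d" by (rule par_exhaust)
      have "f dvd h * (c + h * d) + d * ([:0, 1:] - h ^ 2)"
        using z(1) * by (intro dvd_add) (auto simp: zc iff)
      then have "f dvd [:0, 1:] * d + h * c" by (simp add: algebra_simps power2_eq_square)
      then show False using z(2) by (simp add: zc par_t par_mult iff)
    qed
    then have "coprime f ([:0, 1:] - h ^ 2)" using irr poly_irreducible_coprime by blast
    then show ?thesis using deg N by blast
  qed
qed

text \<open>Since (t - h)(t + h) = x - h^2, the Bezout identity reads 1 = r f + s (t - h)(t + h);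
  the witnesses are w = s (t - h) and u = r f + s h (t - h).\<close>

lemma lattice_full:
  assumes "coprime f ([:0, 1:] - h ^ 2)"
  shows "\<exists>u\<in>nodal_lattice f h. \<exists>w\<in>nodal_lattice f h. 1 = u + [:0, 1:] * w"
proof -
  obtain r s where rs: "r * f + s * ([:0, 1:] - h ^ 2) = 1"
    using assms by (rule poly_coprime_bezout)
  have "r * f - s * h * h + h * (s * h) = f * r" by (simp add: mult_ac)
  then have "par (r * f - s * h * h) (s * h) \<in> nodal_lattice f h" by simp
  moreover have "par (- (s * h)) s \<in> nodal_lattice f h" by (simp add: mult.commute)
  moreover have "par 1 0 = par (r * f - s * h * h) (s * h) + [:0, 1:] * par (- (s * h)) s"
  proof -
    have "r * f - s * h * h + [:0, 1:] * s = r * f + s * ([:0, 1:] - h ^ 2)"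
      by (simp only: ring_distribs power2_eq_square) (simp add: mult_ac)
    then have "r * f - s * h * h + [:0, 1:] * s = 1" by (simp only: rs)
    then show ?thesis by (simp add: par_t par_mult par_add)
  qed
  ultimately show ?thesis by (metis par_1)
qed

lemma one_in_order: "1 \<in> nodal_order f"
  by (metis par_in_order par_1 dvd_0_right)

lemma order_full: "\<exists>u\<in>nodal_order f. \<exists>w\<in>nodal_order f. 1 = u + [:0, 1:] * w"
  by (rule bexI[of _ 1], rule bexI[of _ 0])
    (simp_all add: one_in_order submodule_order[unfolded submodule_of_def])

text \<open>From c + d t = (c + h d) + d (t - h). Multiplied by f, the generators f and t - h become
  f^2 and y - h f.\<close>

lemma lattice_gen:
  "nodal_lattice f h =
     {par f 0 * a + par (- h) 1 * b | a b. a \<in> nodal_order f \<and> b \<in> nodal_order f}"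
proof (intro equalityI subsetI)
  fix z assume z: "z \<in> nodal_lattice f h"
  obtain c d where zc: "z = par c d" by (rule par_exhaust)
  with z obtain e where "c + h * d = f * e" by auto
  then have "z = par f 0 * par e 0 + par (- h) 1 * par d 0"
    by (simp add: zc par_mult par_add algebra_simps)
  then show "z \<in> {par f 0 * a + par (- h) 1 * b | a b. a \<in> nodal_order f \<and> b \<in> nodal_order f}"
    by fastforce
next
  fix z assume "z \<in> {par f 0 * a + par (- h) 1 * b | a b. a \<in> nodal_order f \<and> b \<in> nodal_order f}"
  then obtain a b where z: "z = a * par f 0 + b * par (- h) 1" "a \<in> nodal_order f" "b \<in> nodal_order f"
    by (auto simp: mult.commute)
  then show "z \<in> nodal_lattice f h"
    using submodule_lattice[of f h] by (simp add: submodule_of_def)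
qed

section \<open>Scaling a module until it generates F[t], and uniqueness of the scale\<close>

text \<open>The generator \<open>g\<close> comes from the principal ideal \<open>s (S + t S) = s S F[t]\<close> of \<open>F[t]\<close>.\<close>

lemma lattice_normalization:
  fixes f :: "'a::field poly"
  defines "A \<equiv> to_fract ` nodal_order f"
  assumes sub: "submodule_of A S" and s: "s \<noteq> 0" "(*) s ` S \<subseteq> range to_fract" and nz: "\<not> S \<subseteq> {0}"
  obtains g N u w where "g \<noteq> 0" "S = (*) g ` to_fract ` N" "submodule_of (nodal_order f) N"
    "u \<in> N" "w \<in> N" "1 = u + [:0, 1:] * w"
proof -
  define t :: "'a poly fract" where "t = to_fract [:0, 1:]"
  have S0: "0 \<in> S" and Sadd: "\<And>x y. x \<in> S \<Longrightarrow> y \<in> S \<Longrightarrow> x + y \<in> S"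
    and Smul: "\<And>a x. a \<in> nodal_order f \<Longrightarrow> x \<in> S \<Longrightarrow> to_fract a * x \<in> S"
    using sub by (auto simp: submodule_of_def A_def)
  define K where "K = {p. \<exists>x\<in>S. \<exists>y\<in>S. to_fract p = s * (x + t * y)}"
  obtain k where k: "K = range ((*) k)"
  proof (rule poly_ideal_principal[of K])
    show "0 \<in> K" using S0 by (force simp: K_def)
  next
    fix p q assume "p \<in> K" "q \<in> K"
    then obtain x y x' y' where *: "x \<in> S" "y \<in> S" "x' \<in> S" "y' \<in> S"
      "to_fract p = s * (x + t * y)" "to_fract q = s * (x' + t * y')"
      by (auto simp: K_def)
    have "to_fract (p + q) = s * ((x + x') + t * (y + y'))" by (simp add: * algebra_simps)
    then show "p + q \<in> K" unfolding K_def using * Sadd by blast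
  next
    fix r p :: "'a poly" assume "p \<in> K"
    then obtain x y where *: "x \<in> S" "y \<in> S" "to_fract p = s * (x + t * y)"
      by (auto simp: K_def)
    \<comment> \<open>\<open>S\<close> is closed under the order only, so \<open>r\<close> is split
      as a + b t with a, b in F[x]; these lie in the order, and so does t * t = x.\<close>
    obtain a b where r: "r = par a b" by (rule par_exhaust)
    have "r = par a 0 + [:0, 1:] * par b 0" by (simp add: r par_t par_mult par_add)
    then have r': "to_fract r = to_fract (par a 0) + t * to_fract (par b 0)"
      by (simp only: to_fract_add to_fract_mult t_def)
    have tt: "t * t = to_fract (par [:0, 1:] 0)"
      by (simp add: t_def par_t par_mult flip: to_fract_mult)
    have "to_fract (r * p) = s * ((to_fract (par a 0) * x + to_fract (par b 0) * (t * t) * y)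
        + t * (to_fract (par b 0) * x + to_fract (par a 0) * y))"
      by (simp only: to_fract_mult r' *(3)) (simp add: algebra_simps)
    also have "to_fract (par b 0) * (t * t) = to_fract (par (b * [:0, 1:]) 0)"
      by (simp add: tt par_mult flip: to_fract_mult)
    finally have "to_fract (r * p) = s * ((to_fract (par a 0) * x + to_fract (par (b * [:0, 1:]) 0) * y)
        + t * (to_fract (par b 0) * x + to_fract (par a 0) * y))" .
    moreover have "to_fract (par a 0) * x + to_fract (par (b * [:0, 1:]) 0) * y \<in> S"
        "to_fract (par b 0) * x + to_fract (par a 0) * y \<in> S"
      by (intro Sadd Smul * par_in_order[THEN iffD2] dvd_0_right)+
    ultimately show "r * p \<in> K" unfolding K_def by blast
  qed
  \<comment> \<open>Division of s (S + t S) = k F[t] by s gives S + t S = g F[t], so every element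
    of \<open>S\<close> is a polynomial multiple of g.\<close>
  define g where "g = to_fract k / s"
  have S_sub: "\<exists>p. x = g * to_fract p" if "x \<in> S" for x
  proof -
    have "s * x \<in> range to_fract" using s(2) imageI[OF that] by (rule subsetD)
    then obtain q where q: "s * x = to_fract q" by (rule rangeE)
    then have "to_fract q = s * (x + t * 0)" by simp
    then have "q \<in> K" unfolding K_def using that S0 by blast
    then obtain p where "q = k * p" using k by blast
    then have "x = g * to_fract p" using q s(1) by (simp add: g_def field_simps)
    then show ?thesis ..
  qed
  define N where "N = {p. g * to_fract p \<in> S}"
  have SN: "S = (*) g ` to_fract ` N" using S_sub by (force simp: N_def)
  have g0: "g \<noteq> 0" using nz SN by auto
  have Nsub: "submodule_of (nodal_order f) N"
    unfolding submodule_of_def N_def using S0 Sadd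
    by (auto simp: distrib_left) (metis Smul mult.left_commute)
  \<comment> \<open>The generator \<open>k\<close> itself has the form s (x + t y); division by s g
    turns this into 1 = u + t w.\<close>
  have "k \<in> K" unfolding k by (rule range_eqI[of _ _ 1]) simp
  then obtain x y where xy: "x \<in> S" "y \<in> S" "to_fract k = s * (x + t * y)"
    unfolding K_def by blast
  obtain u w where uw: "x = g * to_fract u" "y = g * to_fract w" using S_sub xy by metis
  have "g = x + t * y" using s(1) by (simp add: g_def xy(3))
  also have "\<dots> = g * (to_fract u + t * to_fract w)" by (simp only: uw distrib_left mult.left_commute)
  finally have "to_fract u + t * to_fract w = 1"
    using g0 by (metis mult_cancel_left mult_1_right)
  then have "to_fract 1 = to_fract (u + [:0, 1:] * w)"
    by (simp only: t_def to_fract_add to_fract_mult to_fract_1)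
  then have "1 = u + [:0, 1:] * w" by (simp only: to_fract_eq_iff)
  moreover have "u \<in> N" "w \<in> N" using xy uw by (simp_all add: N_def)
  ultimately show ?thesis using g0 SN Nsub by (intro that)
qed

text \<open>Multiplication by \<open>g\<close> preserves \<open>F[t]\<close>, so it is a unit of \<open>F[t]\<close>.\<close>

lemma full_scale_eq:
  fixes f :: "'a::field poly"
  assumes N: "submodule_of (nodal_order f) N" "u \<in> N" "w \<in> N" "1 = u + [:0, 1:] * w"
    and M: "submodule_of (nodal_order f) M" "u' \<in> M" "w' \<in> M" "1 = u' + [:0, 1:] * w'"
    and g: "g \<noteq> 0" "to_fract ` N = (*) g ` to_fract ` M"
  shows "N = M"
proof -
  \<comment> \<open>Since 1 lies in M + t M, g lies in g M + t g M = N + t N, so g is a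
    polynomial.\<close>
  have "g = g * to_fract (u' + [:0, 1:] * w')" by (simp only: M(4)[symmetric] to_fract_1 mult_1_right)
  also have "\<dots> = g * to_fract u' + to_fract [:0, 1:] * (g * to_fract w')"
    by (simp only: to_fract_add to_fract_mult distrib_left mult.left_commute)
  finally have g1: "g = g * to_fract u' + to_fract [:0, 1:] * (g * to_fract w')" .
  have "g * to_fract u' \<in> to_fract ` N" "g * to_fract w' \<in> to_fract ` N"
    unfolding g(2) using M(2,3) by (auto intro: imageI)
  then obtain p q where "g * to_fract u' = to_fract p" "g * to_fract w' = to_fract q" by blast
  then have gp: "g = to_fract (p + [:0, 1:] * q)" (is "_ = to_fract ?c")
    using g1 by (simp only: to_fract_add to_fract_mult)
  \<comment> \<open>Since 1 lies in N + t N, it is in turn a polynomial multiple of g.\<close>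
  have "to_fract u \<in> (*) g ` to_fract ` M" "to_fract w \<in> (*) g ` to_fract ` M"
    unfolding g(2)[symmetric] using N(2,3) by simp_all
  then obtain a b where ab: "a \<in> M" "b \<in> M" "to_fract u = g * to_fract a" "to_fract w = g * to_fract b"
    by blast
  have "to_fract 1 = to_fract u + to_fract [:0, 1:] * to_fract w"
    unfolding to_fract_add[symmetric] to_fract_mult[symmetric] N(4)[symmetric] ..
  also have "\<dots> = to_fract (?c * (a + [:0, 1:] * b))"
    unfolding ab gp by (simp only: to_fract_add to_fract_mult distrib_left mult_ac add_ac)
  finally have "1 = ?c * (a + [:0, 1:] * b)" by (simp only: to_fract_eq_iff)
  then have "is_unit ?c" by (rule dvdI)
  then obtain c where c: "?c = [:c:]" "c dvd 1" unfolding is_unit_poly_iff by blast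
  then have "c \<noteq> 0" by auto
  \<comment> \<open>Constants lie in the order, so scaling by the nonzero constant \<open>c\<close>
    maps \<open>M\<close> onto itself.\<close>
  have const: "[:e:] * x \<in> M" if "x \<in> M" for e x
  proof -
    have "[:e:] \<in> nodal_order f" by (subst par_const) simp
    then show ?thesis using M(1) that by (simp only: submodule_of_def)
  qed
  have "to_fract ` N = to_fract ` (*) [:c:] ` M"
    unfolding g(2) gp c(1) by (simp add: image_image flip: to_fract_mult)
  then have "N = (*) [:c:] ` M"
    by (subst (asm) inj_image_eq_iff) (auto intro: injI)
  also have "\<dots> = M"
  proof (intro equalityI subsetI)
    fix x assume "x \<in> M"
    moreover have "x = [:c:] * ([:inverse c:] * x)" using \<open>c \<noteq> 0\<close> by simp
    ultimately show "x \<in> (*) [:c:] ` M" using const by blast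
  qed (use const in auto)
  finally show ?thesis .
qed

section \<open>The class group of a domain with an explicit field of fractions\<close>

lemmas ring_of_type_algebra_simps =
  ring_of_type_algebra_def[THEN arg_cong, of carrier, simplified]
  ring_of_type_algebra_def[THEN arg_cong, of monoid.mult, simplified]
  ring_of_type_algebra_def[THEN arg_cong, of monoid.one, simplified]
  ring_of_type_algebra_def[THEN arg_cong, of ring.zero, simplified]
  ring_of_type_algebra_def[THEN arg_cong, of ring.add, simplified]

text \<open>\<open>\<phi>\<close> realizes the field of fractions of R as an ordinary field type, so
  that ideals become sets of field elements and the class group can be computed without equivalence
  classes.\<close>

locale fraction_model = cring R for R (structure) +
  fixes \<phi> :: "'a \<Rightarrow> 'l::field"
  assumes hom: "\<phi> \<in> ring_hom R ring_of_type_algebra"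
    and inj: "inj_on \<phi> (carrier R)"
    and quot: "\<exists>a\<in>carrier R. \<exists>b\<in>carrier R. \<phi> b \<noteq> 0 \<and> z = \<phi> a / \<phi> b"
begin

lemma hom_simps [simp]:
  "a \<in> carrier R \<Longrightarrow> b \<in> carrier R \<Longrightarrow> \<phi> (a \<otimes> b) = \<phi> a * \<phi> b"
  "a \<in> carrier R \<Longrightarrow> b \<in> carrier R \<Longrightarrow> \<phi> (a \<oplus> b) = \<phi> a + \<phi> b"
  "\<phi> \<one> = 1"
  using hom by (auto simp: ring_hom_def ring_of_type_algebra_simps)

lemma hom_zero [simp]: "\<phi> \<zero> = 0"
  by (metis add_cancel_left_left hom_simps(2) l_zero zero_closed)

lemma hom_inject: "a \<in> carrier R \<Longrightarrow> b \<in> carrier R \<Longrightarrow> \<phi> a = \<phi> b \<longleftrightarrow> a = b"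
  using inj by (auto dest: inj_onD)

lemma hom_eq_0 [simp]: "a \<in> carrier R \<Longrightarrow> \<phi> a = 0 \<longleftrightarrow> a = \<zero>"
  using hom_inject[of a \<zero>] by simp

section \<open>The fraction field as classes of pairs\<close>

text \<open>The element of \<^const>\<open>fraction_field\<close> corresponding to \<open>z\<close>, as an equivalence class.\<close>

definition pairs :: "'l \<Rightarrow> ('a \<times> 'a) set" where
  "pairs z = {(a, b). a \<in> carrier R \<and> b \<in> carrier R - {\<zero>} \<and> \<phi> a = z * \<phi> b}"

lemma fraction_eq:
  assumes "a \<in> carrier R" "b \<in> carrier R - {\<zero>}"
  shows "fraction R a b = pairs (\<phi> a / \<phi> b)"
proof -
  have "a \<otimes> d = c \<otimes> b \<longleftrightarrow> \<phi> c = \<phi> a / \<phi> b * \<phi> d"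
    if "c \<in> carrier R" "d \<in> carrier R" for c d
    using that assms hom_inject[of "a \<otimes> d" "c \<otimes> b"] by (auto simp: field_simps)
  then show ?thesis
    using assms by (auto simp: fraction_def fract_rel_def pairs_def)
qed

lemma pairs_memD:
  "p \<in> pairs z \<Longrightarrow> fst p \<in> carrier R \<and> snd p \<in> carrier R \<and> snd p \<noteq> \<zero> \<and> \<phi> (fst p) / \<phi> (snd p) = z"
  by (auto simp: pairs_def field_simps)

lemma pairs_exhaust:
  obtains a b where "a \<in> carrier R" "b \<in> carrier R - {\<zero>}" "(a, b) \<in> pairs z" "pairs z = fraction R a b"
proof -
  obtain a b where "a \<in> carrier R" "b \<in> carrier R" "\<phi> b \<noteq> 0" "z = \<phi> a / \<phi> b"
    using quot[of z] by blast
  then show ?thesis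
    by (intro that[of a b]) (auto simp: fraction_eq pairs_def)
qed

lemma pairs_inject [simp]: "pairs z = pairs w \<longleftrightarrow> z = w"
  by (metis pairs_memD pairs_exhaust)

lemma inj_pairs: "inj pairs"
  by (rule injI) simp

lemma image_pairs_inject [simp]: "pairs ` S = pairs ` T \<longleftrightarrow> S = T"
  using inj_pairs by (rule inj_image_eq_iff)

lemma zero_product: "a \<in> carrier R \<Longrightarrow> b \<in> carrier R \<Longrightarrow> a \<otimes> b = \<zero> \<longleftrightarrow> a = \<zero> \<or> b = \<zero>"
  by (metis hom_eq_0 hom_simps(1) m_closed mult_eq_0_iff)

text \<open>The operations of \<open>fraction_field\<close> are unions over representatives; this
  collapses them once the result is independent of the choice, because every class is
  nonempty.\<close>

lemma union_pairs_const:
  assumes "\<And>p q. p \<in> pairs z \<Longrightarrow> q \<in> pairs w \<Longrightarrow> F p q = c"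
  shows "(\<Union>p\<in>pairs z. \<Union>q\<in>pairs w. F p q) = c"
proof -
  have "pairs z \<noteq> {}" "pairs w \<noteq> {}" by (metis pairs_exhaust empty_iff)+
  then show ?thesis using assms by auto
qed

lemma fraction_field_simps:
  "carrier (fraction_field R) = range pairs"
  "\<one>\<^bsub>fraction_field R\<^esub> = pairs 1"
  "\<zero>\<^bsub>fraction_field R\<^esub> = pairs 0"
  "pairs z \<otimes>\<^bsub>fraction_field R\<^esub> pairs w = pairs (z * w)"
  "pairs z \<oplus>\<^bsub>fraction_field R\<^esub> pairs w = pairs (z + w)"
proof -
  have one: "\<one> \<noteq> \<zero>" using hom_simps(3) hom_zero by force
  show "\<one>\<^bsub>fraction_field R\<^esub> = pairs 1" "\<zero>\<^bsub>fraction_field R\<^esub> = pairs 0"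
    using one by (simp_all add: fraction_field_def fraction_eq)
  show "carrier (fraction_field R) = range pairs"
  proof (intro equalityI subsetI)
    fix S assume "S \<in> carrier (fraction_field R)"
    then obtain a b where "a \<in> carrier R" "b \<in> carrier R - {\<zero>}" "S = fraction R a b"
      by (auto simp: fraction_field_def quotient_def fraction_def)
    then show "S \<in> range pairs" by (simp add: fraction_eq)
  next
    fix S assume "S \<in> range pairs"
    then obtain a b where "a \<in> carrier R" "b \<in> carrier R - {\<zero>}" "S = fraction R a b"
      by (metis pairs_exhaust imageE)
    then show "S \<in> carrier (fraction_field R)"
      by (auto simp: fraction_field_def quotient_def fraction_def)
  qed
  have "fraction R (fst p \<otimes> fst q) (snd p \<otimes> snd q) = pairs (z * w)"
    if "p \<in> pairs z" "q \<in> pairs w" for p q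
    using pairs_memD[OF that(1)] pairs_memD[OF that(2)]
    by (subst fraction_eq) (auto simp: zero_product)
  from union_pairs_const[OF this]
  show "pairs z \<otimes>\<^bsub>fraction_field R\<^esub> pairs w = pairs (z * w)"
    by (simp add: fraction_field_def)
  have "fraction R (fst p \<otimes> snd q \<oplus> fst q \<otimes> snd p) (snd p \<otimes> snd q) = pairs (z + w)"
    if "p \<in> pairs z" "q \<in> pairs w" for p q
    using pairs_memD[OF that(1)] pairs_memD[OF that(2)]
    by (subst fraction_eq) (auto simp: zero_product add_frac_eq)
  from union_pairs_const[OF this]
  show "pairs z \<oplus>\<^bsub>fraction_field R\<^esub> pairs w = pairs (z + w)"
    by (simp add: fraction_field_def)
qed

lemma to_fraction_eq: "r \<in> carrier R \<Longrightarrow> to_fraction R r = pairs (\<phi> r)"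
  using hom_simps(3) hom_zero unfolding to_fraction_def by (subst fraction_eq) fastforce+

lemma to_fraction_image: "S \<subseteq> carrier R \<Longrightarrow> to_fraction R ` S = pairs ` \<phi> ` S"
  by (auto simp: to_fraction_eq image_image intro!: image_cong)

section \<open>Fractional ideals as sets of field elements\<close>

abbreviation base :: "'l set" where
  "base \<equiv> \<phi> ` carrier R"

lemma ideal_prod_pairs:
  "ideal_prod (fraction_field R) (pairs ` S) (pairs ` T) = pairs ` ideal_prod ring_of_type_algebra S T"
proof (intro equalityI subsetI)
  fix x assume "x \<in> ideal_prod (fraction_field R) (pairs ` S) (pairs ` T)"
  then show "x \<in> pairs ` ideal_prod ring_of_type_algebra S T"
  proof induction
    case (prod i j)
    then show ?case
      using ideal_prod.prod[of _ S _ T "ring_of_type_algebra :: 'l ring"]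
      by (auto simp: fraction_field_simps ring_of_type_algebra_simps)
  next
    case (sum s1 s2)
    then show ?case
      using ideal_prod.sum[of _ "ring_of_type_algebra :: 'l ring" S T]
      by (auto simp: fraction_field_simps ring_of_type_algebra_simps)
  qed
next
  fix x assume "x \<in> pairs ` ideal_prod ring_of_type_algebra S T"
  then obtain z where x: "x = pairs z" and "z \<in> ideal_prod ring_of_type_algebra S T" by blast
  from this(2) have "pairs z \<in> ideal_prod (fraction_field R) (pairs ` S) (pairs ` T)"
  proof induction
    case (prod i j)
    then show ?case
      using ideal_prod.prod[of "pairs i" "pairs ` S" "pairs j" "pairs ` T" "fraction_field R"]
      by (auto simp: fraction_field_simps ring_of_type_algebra_simps)
  next
    case (sum s1 s2)
    then show ?case
      using ideal_prod.sum[of "pairs s1" "fraction_field R" "pairs ` S" "pairs ` T" "pairs s2"]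
      by (auto simp: fraction_field_simps ring_of_type_algebra_simps)
  qed
  then show "x \<in> ideal_prod (fraction_field R) (pairs ` S) (pairs ` T)" by (simp add: x)
qed

lemma fractional_idealE:
  assumes "fractional_ideal R I"
  obtains S s where "I = pairs ` S" "submodule_of base S" "s \<in> base" "s \<noteq> 0" "(*) s ` S \<subseteq> base"
proof -
  have sub: "additive_subgroup I (fraction_field R)"
    and mul: "\<And>r x. r \<in> carrier R \<Longrightarrow> x \<in> I \<Longrightarrow> to_fraction R r \<otimes>\<^bsub>fraction_field R\<^esub> x \<in> I"
    using assms by (auto simp: fractional_ideal_def)
  obtain s where s: "s \<in> carrier R - {\<zero>}"
    and den: "\<And>x. x \<in> I \<Longrightarrow> to_fraction R s \<otimes>\<^bsub>fraction_field R\<^esub> x \<in> to_fraction R ` carrier R"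
    using assms unfolding fractional_ideal_def by metis
  have "I \<subseteq> range pairs"
    using additive_subgroup.a_subset[OF sub] by (simp add: fraction_field_simps)
  then obtain S where I: "I = pairs ` S" by (metis subset_image_iff)
  have "submodule_of base S"
    unfolding submodule_of_def
  proof (intro conjI ballI)
    show "0 \<in> S"
      using additive_subgroup.zero_closed[OF sub] by (auto simp: fraction_field_simps I)
    fix x y assume "y \<in> S"
    {
      assume "x \<in> S"
      then show "x + y \<in> S"
        using additive_subgroup.a_closed[OF sub, of "pairs x" "pairs y"] \<open>y \<in> S\<close>
        by (auto simp: fraction_field_simps I)
    }
    assume "x \<in> base"
    then show "x * y \<in> S"
      using mul[of _ "pairs y"] \<open>y \<in> S\<close>
      by (auto simp: fraction_field_simps I to_fraction_eq image_iff)
  qed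
  moreover have "(*) (\<phi> s) ` S \<subseteq> base"
  proof
    fix z assume "z \<in> (*) (\<phi> s) ` S"
    then obtain x where "x \<in> S" "z = \<phi> s * x" by blast
    then show "z \<in> base"
      using den[of "pairs x"] s by (auto simp: fraction_field_simps I to_fraction_eq)
  qed
  ultimately show ?thesis using I s by (intro that[of S "\<phi> s"]) auto
qed

section \<open>Principal ideals and ideal classes\<close>

lemma principal_ideals_eq: "principal_ideals R = {pairs ` (*) g ` base | g. g \<noteq> 0}"
proof -
  let ?F = "\<lambda>g. (\<lambda>r. g \<otimes>\<^bsub>fraction_field R\<^esub> to_fraction R r) ` carrier R"
  have "?F (pairs g) = pairs ` (*) g ` base" for g
    by (auto simp: to_fraction_eq fraction_field_simps image_image intro!: image_cong)
  moreover have "principal_ideals R = ?F ` (range pairs - {pairs 0})"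
    unfolding principal_ideals_def fraction_field_simps by (simp only: setcompr_eq_image Collect_mem_eq)
  moreover have "range pairs - {pairs 0} = pairs ` {g. g \<noteq> 0}" by auto
  ultimately show ?thesis by (simp only: image_image setcompr_eq_image)
qed

lemma principal_prod:
  assumes "submodule_of base S"
  shows "ideal_prod ring_of_type_algebra ((*) g ` base) S = (*) g ` S"
proof (intro equalityI subsetI)
  fix x assume "x \<in> ideal_prod ring_of_type_algebra ((*) g ` base) S"
  then show "x \<in> (*) g ` S"
  proof induction
    case (prod i j)
    then show ?case using assms by (auto simp: ring_of_type_algebra_simps submodule_of_def mult.assoc)
  next
    case (sum s1 s2)
    then show ?case using assms
      by (auto simp: ring_of_type_algebra_simps submodule_of_def simp flip: distrib_left)
  qed
next
  fix x assume "x \<in> (*) g ` S"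
  then obtain y where y: "y \<in> S" "x = g * y" by blast
  have "g * \<phi> \<one> \<in> (*) g ` base" by blast
  from ideal_prod.prod[OF this y(1), of ring_of_type_algebra]
  show "x \<in> ideal_prod ring_of_type_algebra ((*) g ` base) S"
    by (simp add: y ring_of_type_algebra_simps)
qed

text \<open>The class of an ideal: multiplication by a principal ideal is scaling by its generator,
  so a coset of the principal ideals consists of the nonzero multiples of S.\<close>

definition orbit :: "'l set \<Rightarrow> ('a \<times> 'a) set set set" where
  "orbit S = {pairs ` (*) g ` S | g. g \<noteq> 0}"

lemma coset_eq_orbit:
  assumes "submodule_of base S"
  shows "principal_ideals R #>\<^bsub>invertible_ideals R\<^esub> (pairs ` S) = orbit S"
  unfolding r_coset_def principal_ideals_eq orbit_def
  by (simp add: invertible_ideals_def)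
    (auto simp: ideal_prod_pairs principal_prod[OF assms])

lemma principal_ideals_eq_orbit: "principal_ideals R = orbit base"
  by (simp add: principal_ideals_eq orbit_def)

lemma orbit_eq_iff: "orbit S = orbit T \<longleftrightarrow> (\<exists>g. g \<noteq> 0 \<and> S = (*) g ` T)"
proof
  have "pairs ` (*) 1 ` S \<in> orbit S" unfolding orbit_def by (rule CollectI, rule exI[of _ 1]) simp
  moreover assume "orbit S = orbit T"
  ultimately have "pairs ` (*) 1 ` S \<in> orbit T" by simp
  then show "\<exists>g. g \<noteq> 0 \<and> S = (*) g ` T" by (auto simp: orbit_def)
next
  assume "\<exists>g. g \<noteq> 0 \<and> S = (*) g ` T"
  then obtain g where g: "g \<noteq> 0" "S = (*) g ` T" by blast
  have "(*) k ` S = (*) (k * g) ` T" for k by (simp add: g image_image mult.assoc)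
  moreover have "(*) k ` T = (*) (k / g) ` S" for k using g by (simp add: image_image)
  ultimately show "orbit S = orbit T"
    unfolding orbit_def using g(1) by (intro Collect_cong) (metis divide_eq_0_iff mult_eq_0_iff)
qed

lemma ideal_class_groupE:
  assumes "D \<in> carrier (ideal_class_group R)"
  obtains S T s where "D = orbit S" "submodule_of base S" "s \<in> base" "s \<noteq> 0" "(*) s ` S \<subseteq> base"
    "ideal_prod ring_of_type_algebra S T = base"
proof -
  obtain I where I: "I \<in> carrier (invertible_ideals R)"
    and D: "D = principal_ideals R #>\<^bsub>invertible_ideals R\<^esub> I"
    using assms by (auto simp: ideal_class_group_def FactGroup_def RCOSETS_def)
  from I obtain J where IJ: "fractional_ideal R I" "fractional_ideal R J"
      "ideal_prod (fraction_field R) I J = to_fraction R ` carrier R"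
    by (auto simp: invertible_ideals_def)
  obtain S s where S: "I = pairs ` S" "submodule_of base S" "s \<in> base" "s \<noteq> 0" "(*) s ` S \<subseteq> base"
    using IJ(1) by (rule fractional_idealE)
  obtain T where T: "J = pairs ` T"
    using IJ(2) by (rule fractional_idealE)
  have "ideal_prod ring_of_type_algebra S T = base"
    using IJ(3) by (simp add: S(1) T ideal_prod_pairs to_fraction_image)
  then show ?thesis using S D by (intro that[of S s T]) (simp_all add: coset_eq_orbit)
qed

lemma ideal_class_group_one: "\<one>\<^bsub>ideal_class_group R\<^esub> = orbit base"
  by (simp add: ideal_class_group_def FactGroup_def principal_ideals_eq_orbit)

text \<open>\<open>genideal\<close> is an intersection of ideals; comparison with the sum of the two
  principal ideals makes its elements explicit.\<close>

lemma genideal_two_image: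
  assumes "u \<in> carrier R" "v \<in> carrier R"
  shows "\<phi> ` genideal R {u, v} = {\<phi> u * a + \<phi> v * b | a b. a \<in> base \<and> b \<in> base}"
proof -
  have "genideal R {u, v} = PIdl u <+>\<^bsub>R\<^esub> PIdl v"
  proof
    have "\<zero> \<in> PIdl u" "\<zero> \<in> PIdl v"
      using assms by (auto intro!: additive_subgroup.zero_closed ideal.axioms(1) cgenideal_ideal)
    then have "{u, v} \<subseteq> PIdl u <+>\<^bsub>R\<^esub> PIdl v"
      using assms cgenideal_self[of u] cgenideal_self[of v] unfolding set_add_def' by force
    then show "genideal R {u, v} \<subseteq> PIdl u <+>\<^bsub>R\<^esub> PIdl v"
      using assms by (intro genideal_minimal add_ideals cgenideal_ideal)
    interpret I: ideal "genideal R {u, v}" R using assms by (intro genideal_ideal) auto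
    have "u \<in> genideal R {u, v}" "v \<in> genideal R {u, v}"
      using genideal_self[of "{u, v}"] assms by auto
    then show "PIdl u <+>\<^bsub>R\<^esub> PIdl v \<subseteq> genideal R {u, v}"
      by (auto simp: set_add_def' cgenideal_def I.I_l_closed)
  qed
  also have "\<phi> ` \<dots> = {\<phi> u * a + \<phi> v * b | a b. a \<in> base \<and> b \<in> base}"
    using assms by (force simp: set_add_def' cgenideal_def mult.commute image_iff)
  finally show ?thesis .
qed

lemma submodule_base: "submodule_of base base"
  unfolding submodule_of_def
proof (intro conjI ballI)
  show "0 \<in> base" by (rule image_eqI[of _ _ \<zero>]) simp_all
  fix x y assume "x \<in> base" "y \<in> base"
  then obtain a b where "a \<in> carrier R" "b \<in> carrier R" "x = \<phi> a" "y = \<phi> b" by blast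
  then show "x + y \<in> base" "x * y \<in> base"
    by (auto intro: image_eqI[of _ _ "a \<oplus> b"] image_eqI[of _ _ "a \<otimes> b"])
qed

lemma coset_genideal:
  assumes "u \<in> carrier R" "v \<in> carrier R"
  shows "principal_ideals R #>\<^bsub>invertible_ideals R\<^esub> (to_fraction R ` genideal R {u, v}) =
    orbit {\<phi> u * a + \<phi> v * b | a b. a \<in> base \<and> b \<in> base}"
proof -
  let ?G = "{\<phi> u * a + \<phi> v * b | a b. a \<in> base \<and> b \<in> base}"
  have G: "\<phi> u * a + \<phi> v * b \<in> ?G" if "a \<in> base" "b \<in> base" for a b using that by blast
  have base: "0 \<in> base" "\<And>a b. a \<in> base \<Longrightarrow> b \<in> base \<Longrightarrow> a + b \<in> base"
    "\<And>a b. a \<in> base \<Longrightarrow> b \<in> base \<Longrightarrow> a * b \<in> base"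
    using submodule_base unfolding submodule_of_def by meson+
  have "submodule_of base ?G"
    unfolding submodule_of_def
  proof (intro conjI ballI)
    show "0 \<in> ?G" using G[OF base(1) base(1)] by simp
  next
    fix x y assume "x \<in> ?G" "y \<in> ?G"
    then obtain a b c d where *: "a \<in> base" "b \<in> base" "c \<in> base" "d \<in> base"
      "x = \<phi> u * a + \<phi> v * b" "y = \<phi> u * c + \<phi> v * d" by blast
    have "x + y = \<phi> u * (a + c) + \<phi> v * (b + d)" by (simp add: * algebra_simps)
    also have "\<dots> \<in> ?G" using * by (intro G base)
    finally show "x + y \<in> ?G" .
  next
    fix r x assume "r \<in> base" "x \<in> ?G"
    then obtain a b where *: "r \<in> base" "a \<in> base" "b \<in> base" "x = \<phi> u * a + \<phi> v * b" by blast
    have "r * x = \<phi> u * (r * a) + \<phi> v * (r * b)" by (simp add: * algebra_simps)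
    also have "\<dots> \<in> ?G" using * by (intro G base)
    finally show "r * x \<in> ?G" .
  qed
  moreover have "genideal R {u, v} \<subseteq> carrier R"
    using genideal_ideal[of "{u, v}"] assms by (simp add: additive_subgroup.a_subset ideal.axioms(1))
  ultimately show ?thesis
    by (simp add: to_fraction_image genideal_two_image[OF assms] coset_eq_orbit)
qed

end

section \<open>The coordinate ring\<close>

text \<open>The substitution \<open>x \<mapsto> t\<^sup>2\<close>, \<open>y \<mapsto> t f(t\<^sup>2)\<close>, with the coordinate ring as image.\<close>

definition param :: "'a::field poly \<Rightarrow> 'a poly poly \<Rightarrow> 'a poly" where
  "param f p = poly (map_poly (\<lambda>a. par a 0) p) (par 0 f)"

lemma map_poly_par:
  "map_poly (\<lambda>a. par a 0) (p + q) = map_poly (\<lambda>a. par a 0) p + map_poly (\<lambda>a. par a 0) q"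
  "map_poly (\<lambda>a. par a 0) (p * q) = map_poly (\<lambda>a. par a 0) p * map_poly (\<lambda>a. par a 0) q"
proof -
  show add: "map_poly (\<lambda>a. par a 0) (p + q) = map_poly (\<lambda>a. par a 0) p + map_poly (\<lambda>a. par a 0) q" for p q
    by (rule poly_eqI) (simp add: coeff_map_poly par_add)
  show "map_poly (\<lambda>a. par a 0) (p * q) = map_poly (\<lambda>a. par a 0) p * map_poly (\<lambda>a. par a 0) q"
  proof (induction p)
    case (pCons a p)
    have "map_poly (\<lambda>a. par a 0) (smult a q) = smult (par a 0) (map_poly (\<lambda>a. par a 0) q)"
      by (rule poly_eqI) (simp add: coeff_map_poly par_mult)
    then show ?case by (simp add: add pCons map_poly_pCons)
  qed simp
qed

lemma param_simps:
  "param f (p + q) = param f p + param f q"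
  "param f (p * q) = param f p * param f q"
  "param f [:a:] = par a 0"
  "param f [:a, b:] = par a (f * b)"
  "param f 1 = 1"
  by (simp_all add: param_def map_poly_par map_poly_pCons par_mult par_add par_1)

lemma curve_division:
  obtains q a b where "p = q * ([:0, 1:] ^ 2 - [:curve_poly f:]) + [:a, b:]"
proof -
  have "\<exists>q a b. p = q * ([:0, 1:] ^ 2 - [:curve_poly f:]) + [:a, b:]"
  proof (induction p)
    case 0
    show ?case by (rule exI[of _ 0], rule exI[of _ 0], rule exI[of _ 0]) simp
  next
    case (pCons c p)
    then obtain q a b where p: "p = q * ([:0, 1:] ^ 2 - [:curve_poly f:]) + [:a, b:]" by blast
    \<comment> \<open>y (a + b y) = a y + b y^2, and replacing y^2 by \<open>curve_poly f\<close>
      adds b to the quotient.\<close>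
    have "pCons c p = (pCons 0 q + [:b:]) * ([:0, 1:] ^ 2 - [:curve_poly f:]) + [:c + b * curve_poly f, a:]"
      by (simp add: p power2_eq_square algebra_simps)
    then show ?case by blast
  qed
  then show ?thesis using that by blast
qed

lemma param_curve: "param f ([:0, 1:] ^ 2 - [:curve_poly f:]) = 0"
proof -
  have "[:0, 1:] ^ 2 - [:curve_poly f:] = [:0, 1:] * [:0, 1:] + [:- curve_poly f:]"
    by (simp add: power2_eq_square)
  then have "param f ([:0, 1:] ^ 2 - [:curve_poly f:]) =
      param f [:0, 1:] * param f [:0, 1:] + param f [:- curve_poly f:]"
    by (simp only: param_simps)
  also have "\<dots> = 0"
    by (simp add: param_simps par_mult par_add curve_poly_def power2_eq_square)
  finally show ?thesis .
qed

text \<open>The remainder a + b y goes to \<open>par a (f * b)\<close>, which vanishes for a = b = 0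
  only. So the kernel of the substitution is the curve ideal.\<close>

lemma param_eq_0_iff:
  assumes "f \<noteq> 0"
  shows "param f p = 0 \<longleftrightarrow> ([:0, 1:] ^ 2 - [:curve_poly f:]) dvd p"
proof
  assume p: "param f p = 0"
  obtain q a b where q: "p = q * ([:0, 1:] ^ 2 - [:curve_poly f:]) + [:a, b:]"
    by (rule curve_division)
  then have "par a (f * b) = 0"
    using p by (simp only: param_simps param_curve mult_zero_right add_0)
  then have "a = 0" "b = 0" using assms by (simp_all add: par_eq_0_iff)
  then show "([:0, 1:] ^ 2 - [:curve_poly f:]) dvd p" by (simp add: q)
qed (auto simp: dvd_def param_simps(2) param_curve)

lemma range_param: "range (param f) = nodal_order f"
proof (intro equalityI subsetI)
  fix z assume "z \<in> range (param f)"
  then obtain p where "z = param f p" by blast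
  moreover obtain q a b where "p = q * ([:0, 1:] ^ 2 - [:curve_poly f:]) + [:a, b:]"
    by (rule curve_division)
  ultimately have "z = par a (f * b)" by (simp only: param_simps param_curve mult_zero_right add_0)
  then show "z \<in> nodal_order f" by simp
next
  fix z assume "z \<in> nodal_order f"
  then obtain a b where "z = param f [:a, b:]" by (auto simp: nodal_order_def dvd_def param_simps)
  then show "z \<in> range (param f)" by blast
qed

text \<open>The substitution is constant on cosets of the curve ideal, so \<open>the_elem\<close>
  reads off its value there; this is the shape of the map in the first isomorphism theorem.\<close>

definition coord_emb :: "'a::field poly \<Rightarrow> 'a poly poly set \<Rightarrow> 'a poly fract" where
  "coord_emb f C = the_elem ((\<lambda>p. to_fract (param f p)) ` C)"

lemma coord_ring_hom:
  assumes "f \<noteq> 0"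
  shows "ring_hom_ring (ring_of_type_algebra :: 'a::field poly poly ring)
      (ring_of_type_algebra :: 'a poly fract ring) (\<lambda>p. to_fract (param f p))"
    and "a_kernel (ring_of_type_algebra :: 'a::field poly poly ring)
      (ring_of_type_algebra :: 'a poly fract ring) (\<lambda>p. to_fract (param f p)) = curve_ideal f"
proof -
  show "ring_hom_ring (ring_of_type_algebra :: 'a::field poly poly ring)
      (ring_of_type_algebra :: 'a poly fract ring) (\<lambda>p. to_fract (param f p))"
    by (rule ring_hom_ringI) (auto simp: ring_of_type_algebra_simps param_simps)
  let ?P = "ring_of_type_algebra :: 'a poly poly ring"
  interpret P: cring ?P ..
  let ?c = "[:0, 1:] ^ 2 - [:curve_poly f:]"
  have "curve_ideal f = PIdl\<^bsub>?P\<^esub> ?c"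
    unfolding curve_ideal_def
    by (rule P.cgenideal_eq_genideal[symmetric]) (simp add: ring_of_type_algebra_simps)
  then show "a_kernel (ring_of_type_algebra :: 'a::field poly poly ring)
      (ring_of_type_algebra :: 'a poly fract ring) (\<lambda>p. to_fract (param f p)) = curve_ideal f"
    using param_eq_0_iff[OF assms]
    by (auto simp: a_kernel_def' cgenideal_def ring_of_type_algebra_simps dvd_def mult.commute)
qed

text \<open>First isomorphism theorem for the substitution, with kernel \<open>curve_ideal f\<close>
  and image the order.\<close>

lemma coord_emb:
  fixes f :: "'a::field poly"
  assumes "f \<noteq> 0"
  shows "coord_emb f \<in> ring_hom (coord_ring f) ring_of_type_algebra"
    and "inj_on (coord_emb f) (carrier (coord_ring f))"
    and "coord_emb f ` carrier (coord_ring f) = to_fract ` nodal_order f"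
    and "to_coord_ring f p \<in> carrier (coord_ring f)"
    and "coord_emb f (to_coord_ring f p) = to_fract (param f p)"
    and "cring (coord_ring f)"
proof -
  let ?P = "ring_of_type_algebra :: 'a poly poly ring"
  let ?L = "ring_of_type_algebra :: 'a poly fract ring"
  let ?h = "\<lambda>p. to_fract (param f p)"
  interpret P: cring ?P ..
  interpret L: cring ?L ..
  interpret h: ring_hom_ring ?P ?L ?h using assms by (rule coord_ring_hom)
  note ker = coord_ring_hom(2)[OF assms]
  have id: "ideal (curve_ideal f) ?P" unfolding ker[symmetric] by (rule h.kernel_is_ideal)
  then show "cring (coord_ring f)"
    unfolding coord_ring_def by (rule ideal.quotient_is_cring) (rule P.cring_axioms)
  have "coord_emb f = (\<lambda>C. the_elem (?h ` C))" by (rule ext) (simp add: coord_emb_def)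
  then have iso: "coord_emb f \<in> ring_iso (coord_ring f) (?L \<lparr>carrier := ?h ` carrier ?P\<rparr>)"
    using h.FactRing_iso_set_aux by (simp add: ker coord_ring_def)
  then show "coord_emb f \<in> ring_hom (coord_ring f) ?L"
    by (auto simp: ring_iso_def ring_hom_def ring_of_type_algebra_simps)
  have "?h ` carrier ?P = to_fract ` nodal_order f"
    unfolding range_param[symmetric] by (auto simp: ring_of_type_algebra_simps)
  then show "inj_on (coord_emb f) (carrier (coord_ring f))"
      "coord_emb f ` carrier (coord_ring f) = to_fract ` nodal_order f"
    using iso by (auto simp: ring_iso_def bij_betw_def)
  show "to_coord_ring f p \<in> carrier (coord_ring f)"
    by (auto simp: coord_ring_def FactRing_def to_coord_ring_def A_RCOSETS_def' ring_of_type_algebra_simps)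
  have "?h ` to_coord_ring f p = {?h p}"
  proof
    show "?h ` to_coord_ring f p \<subseteq> {?h p}"
    proof
      fix z assume "z \<in> ?h ` to_coord_ring f p"
      then obtain q where q: "q \<in> a_kernel ?P ?L ?h" "z = ?h (q + p)"
        unfolding to_coord_ring_def a_r_coset_def' ker[symmetric]
        by (auto simp: ring_of_type_algebra_simps)
      have "?h q = 0"
        using q(1) unfolding a_kernel_def' by (simp add: ring_of_type_algebra_simps)
      then show "z \<in> {?h p}" by (simp add: q(2) param_simps(1))
    qed
    have "p \<in> to_coord_ring f p"
      unfolding to_coord_ring_def
      using additive_subgroup.zero_closed[OF ideal.axioms(1)[OF id]]
      by (auto simp: a_r_coset_def' ring_of_type_algebra_simps)
    then show "{?h p} \<subseteq> ?h ` to_coord_ring f p" by blast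
  qed
  then show "coord_emb f (to_coord_ring f p) = to_fract (param f p)"
    by (simp add: coord_emb_def)
qed

text \<open>The order and F[t] have the same field of fractions: multiplying numerator and
  denominator by f moves both into the conductor, hence into the order.\<close>

lemma fraction_model_coord_ring:
  fixes f :: "'a::field poly"
  assumes "f \<noteq> 0"
  shows "fraction_model (coord_ring f) (coord_emb f)"
proof (intro fraction_model.intro fraction_model_axioms.intro coord_emb assms)
  fix z :: "'a poly fract"
  obtain p q where z: "z = to_fract p / to_fract q" and q: "q \<noteq> 0"
    by (metis Fract_cases Fract_conv_to_fract)
  have mem: "to_fract (par f 0 * r) \<in> coord_emb f ` carrier (coord_ring f)" for r
  proof -
    obtain a b where "r = par a b" by (rule par_exhaust)
    then show ?thesis by (simp add: coord_emb(3)[OF assms] par_mult)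
  qed
  have "par f 0 \<noteq> 0" using assms by (simp add: par_eq_0_iff)
  then have "z = to_fract (par f 0 * p) / to_fract (par f 0 * q)" "to_fract (par f 0 * q) \<noteq> 0"
    using q by (simp_all add: z)
  moreover obtain a b where ab: "a \<in> carrier (coord_ring f)" "to_fract (par f 0 * p) = coord_emb f a"
      "b \<in> carrier (coord_ring f)" "to_fract (par f 0 * q) = coord_emb f b"
    using mem[of p] mem[of q] by blast
  ultimately have "coord_emb f b \<noteq> 0 \<and> z = coord_emb f a / coord_emb f b"
    by (simp only: not_False_eq_True)
  with ab(1,3) show "\<exists>a\<in>carrier (coord_ring f). \<exists>b\<in>carrier (coord_ring f).
      coord_emb f b \<noteq> 0 \<and> z = coord_emb f a / coord_emb f b"
    by blast
qed

section \<open>The Mumford conditions for [f^2, h f]\<close>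

lemma map_poly_to_ac_mult: "map_poly to_ac (p * q) = map_poly to_ac p * map_poly to_ac q"
  and map_poly_to_ac_add: "map_poly to_ac (p + q) = map_poly to_ac p + map_poly to_ac q"
  by (simp_all add: poly_eq_iff coeff_map_poly coeff_mult to_ac_sum)

text \<open>The quotient in the third condition is x - h^2. A root of f^2 is a root of f, and the
  Bezout identity, evaluated there over the algebraic closure, shows that x - h^2 does not
  vanish.\<close>

lemma mumford_pair_lattice:
  assumes "f \<noteq> 0" "degree_below h (Polynomial.degree f)" "coprime f ([:0, 1:] - h ^ 2)"
  shows "mumford_pair f (f ^ 2) (h * f)"
  unfolding mumford_pair_def
proof (intro conjI allI impI)
  show "f ^ 2 \<noteq> 0" using assms by simp
  \<comment> \<open>For \<open>h = 0\<close> the product is 0, which is below every degree by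
    convention.\<close>
  show "degree_below (h * f) (Polynomial.degree (f ^ 2))"
    using assms by (cases "h = 0") (auto simp: degree_below_def degree_mult_eq degree_power_eq)
  have eq: "curve_poly f - (h * f) ^ 2 = f ^ 2 * ([:0, 1:] - h ^ 2)"
    by (simp only: curve_poly_def power_mult_distrib ring_distribs mult.commute)
  then have "(h * f) ^ 2 - curve_poly f = f ^ 2 * (h ^ 2 - [:0, 1:])"
    by (simp only: ring_distribs) (metis minus_diff_eq)
  then show "f ^ 2 dvd (h * f) ^ 2 - curve_poly f" by simp
  fix a :: "'a alg_closure"
  assume *: "2 \<le> Polynomial.order a (map_poly to_ac (curve_poly f)) \<and>
    [:- a, 1:] dvd map_poly to_ac (f ^ 2) \<and> [:- a, 1:] dvd map_poly to_ac (h * f)"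
  then have af: "poly (map_poly to_ac f) a = 0"
    by (simp add: power2_eq_square map_poly_to_ac_mult poly_eq_0_iff_dvd[symmetric])
  obtain r s where "r * f + s * ([:0, 1:] - h ^ 2) = 1"
    using assms(3) by (rule poly_coprime_bezout)
  then have "poly (map_poly to_ac (r * f + s * ([:0, 1:] - h ^ 2))) a = 1" by simp
  then have "poly (map_poly to_ac ([:0, 1:] - h ^ 2)) a \<noteq> 0"
    using af by (auto simp: map_poly_to_ac_add map_poly_to_ac_mult)
  then show "\<not> [:- a, 1:] dvd map_poly to_ac ((curve_poly f - (h * f) ^ 2) div f ^ 2)"
    unfolding eq using assms(1) by (simp add: poly_eq_0_iff_dvd)
qed

section \<open>Divisor classes\<close>

text \<open>t - h lies in both lattices, so f divides h' - h, whose degree is too small unless it is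
  0.\<close>

lemma lattice_inject:
  assumes "nodal_lattice f h = nodal_lattice f h'"
    and "degree_below h (Polynomial.degree f)" "degree_below h' (Polynomial.degree f)"
  shows "h = h'"
proof -
  have "par (- h) 1 \<in> nodal_lattice f h" by simp
  then have "f dvd h' - h" unfolding assms(1) by simp
  moreover have "h' - h = 0 \<or> Polynomial.degree (h' - h) < Polynomial.degree f"
    using assms(2,3) degree_diff_less[of h' "Polynomial.degree f" h]
    by (auto simp: degree_below_def)
  ultimately show ?thesis by (metis dvd_imp_degree_le eq_iff_diff_eq_0 not_less)
qed

text \<open>The element 1 of the order lies in the lattice only if f divides 1.\<close>

lemma order_neq_lattice:
  assumes "\<not> is_unit f"
  shows "nodal_order f \<noteq> nodal_lattice f h"
proof
  assume "nodal_order f = nodal_lattice f h"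
  then have "par 1 0 \<in> nodal_lattice f h" using par_in_order[of 1 0 f] by simp
  then show False using assms by simp
qed

section \<open>Classes of the order and of the lattices in the Jacobian\<close>

context
  fixes f :: "'a::field poly"
  assumes irr: "Factorial_Ring.irreducible f"
begin

lemma f_nonzero: "f \<noteq> 0" and f_nonunit: "\<not> is_unit f"
  using irr by (auto simp: Factorial_Ring.irreducible_def)

interpretation M: fraction_model "coord_ring f" "coord_emb f"
  using f_nonzero by (rule fraction_model_coord_ring)

lemma base_eq: "coord_emb f ` carrier (coord_ring f) = to_fract ` nodal_order f"
  using f_nonzero by (rule coord_emb(3))

text \<open>Under y = f t, the generator y - v becomes \<open>par (- v) f\<close>.\<close>

lemma mumford_class_eq:
  "mumford_class f u v = M.orbit (to_fract ` {par u 0 * a + par (- v) f * b | a b.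
     a \<in> nodal_order f \<and> b \<in> nodal_order f})"
proof -
  have "mumford_class f u v =
      M.orbit {to_fract (par u 0) * a + to_fract (par (- v) f) * b | a b.
        a \<in> to_fract ` nodal_order f \<and> b \<in> to_fract ` nodal_order f}"
    unfolding mumford_class_def mumford_ideal_def
    by (subst M.coset_genideal) (simp_all add: coord_emb[OF f_nonzero] param_simps)
  also have "{to_fract (par u 0) * a + to_fract (par (- v) f) * b | a b.
        a \<in> to_fract ` nodal_order f \<and> b \<in> to_fract ` nodal_order f} =
      to_fract ` {par u 0 * a + par (- v) f * b | a b. a \<in> nodal_order f \<and> b \<in> nodal_order f}"
    (is "?L = to_fract ` ?R")
  proof (intro equalityI subsetI)
    fix z assume "z \<in> ?L"
    then obtain a b where "a \<in> nodal_order f" "b \<in> nodal_order f"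
      "z = to_fract (par u 0) * to_fract a + to_fract (par (- v) f) * to_fract b" by blast
    moreover from this have "z = to_fract (par u 0 * a + par (- v) f * b)" by simp
    ultimately show "z \<in> to_fract ` ?R" by blast
  next
    fix z assume "z \<in> to_fract ` ?R"
    then obtain a b where "a \<in> nodal_order f" "b \<in> nodal_order f"
      "z = to_fract (par u 0 * a + par (- v) f * b)" by blast
    moreover from this
    have "z = to_fract (par u 0) * to_fract a + to_fract (par (- v) f) * to_fract b" by simp
    ultimately show "z \<in> ?L" by blast
  qed
  finally show ?thesis .
qed

text \<open>Since y - h f = f (t - h), the ideal is f times the lattice, and scaling by f does not
  change the class.\<close>

lemma mumford_class_lattice:
  "mumford_class f (f ^ 2) (h * f) = M.orbit (to_fract ` nodal_lattice f h)"
proof -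
  have "par (f ^ 2) 0 = par f 0 * par f 0" "par (- (h * f)) f = par f 0 * par (- h) 1"
    by (simp_all add: par_mult power2_eq_square mult.commute)
  then have "par (f ^ 2) 0 * a + par (- (h * f)) f * b = par f 0 * (par f 0 * a + par (- h) 1 * b)" for a b
    by (simp only: distrib_left mult.assoc)
  then have "{par (f ^ 2) 0 * a + par (- (h * f)) f * b | a b. a \<in> nodal_order f \<and> b \<in> nodal_order f} =
      (*) (par f 0) ` nodal_lattice f h"
    unfolding lattice_gen by auto
  then have "to_fract ` {par (f ^ 2) 0 * a + par (- (h * f)) f * b | a b.
        a \<in> nodal_order f \<and> b \<in> nodal_order f} =
      (*) (to_fract (par f 0)) ` to_fract ` nodal_lattice f h"
    by (simp only: image_image to_fract_mult)
  moreover have "to_fract (par f 0) \<noteq> 0" using f_nonzero by (simp add: par_eq_0_iff)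
  ultimately show ?thesis
    unfolding mumford_class_eq M.orbit_eq_iff by blast
qed

lemma mumford_class_one: "mumford_class f 1 0 = M.orbit (to_fract ` nodal_order f)"
proof -
  have "{par 1 0 * a + par (- 0) f * b | a b. a \<in> nodal_order f \<and> b \<in> nodal_order f} = nodal_order f"
  proof (intro equalityI subsetI)
    fix x assume "x \<in> nodal_order f"
    then have "x = par 1 0 * x + par (- 0) f * 0" "0 \<in> nodal_order f"
      using submodule_order[of f] by (simp_all add: par_1 submodule_of_def)
    then show "x \<in> {par 1 0 * a + par (- 0) f * b | a b. a \<in> nodal_order f \<and> b \<in> nodal_order f}"
      using \<open>x \<in> nodal_order f\<close> by blast
  next
    fix x assume "x \<in> {par 1 0 * a + par (- 0) f * b | a b. a \<in> nodal_order f \<and> b \<in> nodal_order f}"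
    then show "x \<in> nodal_order f"
      using submodule_order[of f] by (auto simp: submodule_of_def)
  qed
  then show ?thesis by (simp only: mumford_class_eq)
qed

lemma Jac_one: "\<one>\<^bsub>Jac f\<^esub> = M.orbit (to_fract ` nodal_order f)"
  by (simp add: Jac_def M.ideal_class_group_one base_eq)

text \<open>A representative is scaled to a module N with 1 in N + t N; invertibility keeps N from
  being stable under t, and then the classification of lattices applies.\<close>

lemma Jac_classification:
  assumes "D \<in> carrier (Jac f)"
  shows "D = M.orbit (to_fract ` nodal_order f) \<or>
    (\<exists>h. degree_below h (Polynomial.degree f) \<and> coprime f ([:0, 1:] - h ^ 2) \<and>
         D = M.orbit (to_fract ` nodal_lattice f h))"
proof -
  let ?A = "to_fract ` nodal_order f" and ?t = "to_fract [:0, 1 :: 'a:]"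
  obtain S T s where D: "D = M.orbit S" and S: "submodule_of ?A S" "s \<in> ?A" "s \<noteq> 0" "(*) s ` S \<subseteq> ?A"
    and inv: "ideal_prod ring_of_type_algebra S T = ?A"
    using assms unfolding Jac_def by (elim M.ideal_class_groupE) (simp add: base_eq)
  have one: "1 \<in> ideal_prod ring_of_type_algebra S T"
    using one_in_order unfolding inv by (metis imageI to_fract_1)
  \<comment> \<open>If t S were contained in S, then t would preserve S T, which is the order; as
    the order contains 1, it would contain t, although f is not a unit.\<close>
  have stable: False if "\<And>x. x \<in> S \<Longrightarrow> ?t * x \<in> S"
  proof -
    have "?t * z \<in> ideal_prod ring_of_type_algebra S T"
      if "z \<in> ideal_prod ring_of_type_algebra S T" for z
      using that
    proof induction
      case (prod i j)
      have "(?t * i) \<otimes>\<^bsub>ring_of_type_algebra\<^esub> j \<in> ideal_prod ring_of_type_algebra S T"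
        using \<open>\<And>x. x \<in> S \<Longrightarrow> ?t * x \<in> S\<close> prod by (intro ideal_prod.prod) auto
      then show ?case by (simp add: ring_of_type_algebra_simps mult.assoc)
    next
      case (sum x y)
      from ideal_prod.sum[OF sum.IH]
      show ?case by (simp add: ring_of_type_algebra_simps distrib_left)
    qed
    from this[OF one] have "?t \<in> ?A" by (simp add: inv)
    then have "par 0 1 \<in> nodal_order f" by (auto simp: par_t)
    then show False using f_nonunit by simp
  qed
  have nz: "\<not> S \<subseteq> {0}"
  proof
    assume "S \<subseteq> {0}"
    then have "?t * x \<in> S" if "x \<in> S" for x using that by auto
    then show False by (rule stable)
  qed
  have "(*) s ` S \<subseteq> range to_fract" using S(4) by blast
  then obtain g N u w where g: "g \<noteq> 0" "S = (*) g ` to_fract ` N"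
    and N: "submodule_of (nodal_order f) N" "u \<in> N" "w \<in> N" "1 = u + [:0, 1:] * w"
    using lattice_normalization[OF S(1,3) _ nz] by metis
  \<comment> \<open>Scaling by g commutes with multiplication by t, so stability of \<open>N\<close>
    would pass to \<open>S\<close>.\<close>
  have "\<exists>z\<in>N. [:0, 1:] * z \<notin> N"
  proof (rule ccontr)
    assume *: "\<not> ?thesis"
    have "?t * x \<in> S" if x: "x \<in> S" for x
    proof -
      obtain z where z: "z \<in> N" "x = g * to_fract z" using x g(2) by blast
      then have "?t * x = g * to_fract ([:0, 1:] * z)" by (simp only: to_fract_mult mult.left_commute)
      then show ?thesis using * z g(2) by blast
    qed
    then show False by (rule stable)
  qed
  then obtain z where "z \<in> N" "[:0, 1:] * z \<notin> N" by blast
  from lattice_classification[OF irr N this]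
  consider "N = nodal_order f"
    | h where "degree_below h (Polynomial.degree f)" "coprime f ([:0, 1:] - h ^ 2)" "N = nodal_lattice f h"
    by blast
  moreover have "D = M.orbit (to_fract ` N)"
    using g unfolding D M.orbit_eq_iff by blast
  ultimately show ?thesis by cases blast+
qed

text \<open>Equal orbits give modules that differ by a scalar, and \<open>full_scale_eq\<close> then
  makes them equal. So a class has at most one representative of this kind.\<close>

lemma orbit_full_inject:
  assumes N: "submodule_of (nodal_order f) N" "\<exists>u\<in>N. \<exists>w\<in>N. 1 = u + [:0, 1:] * w"
    and N': "submodule_of (nodal_order f) N'" "\<exists>u\<in>N'. \<exists>w\<in>N'. 1 = u + [:0, 1:] * w"
    and orbit: "M.orbit (to_fract ` N) = M.orbit (to_fract ` N')"
  shows "N = N'"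
proof -
  obtain u w where uw: "u \<in> N" "w \<in> N" "1 = u + [:0, 1:] * w" using N(2) by (elim bexE)
  obtain u' w' where uw': "u' \<in> N'" "w' \<in> N'" "1 = u' + [:0, 1:] * w'" using N'(2) by (elim bexE)
  obtain g where "g \<noteq> 0" "to_fract ` N = (*) g ` to_fract ` N'"
    using orbit unfolding M.orbit_eq_iff by (elim exE conjE)
  then show ?thesis by (rule full_scale_eq[OF N(1) uw N'(1) uw'])
qed

lemma orbit_lattice_inject:
  assumes "coprime f ([:0, 1:] - h ^ 2)" "coprime f ([:0, 1:] - h' ^ 2)"
    and "M.orbit (to_fract ` nodal_lattice f h) = M.orbit (to_fract ` nodal_lattice f h')"
  shows "nodal_lattice f h = nodal_lattice f h'"
  using assms by (intro orbit_full_inject submodule_lattice lattice_full)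

lemma orbit_order_neq_lattice:
  assumes "coprime f ([:0, 1:] - h ^ 2)"
  shows "M.orbit (to_fract ` nodal_order f) \<noteq> M.orbit (to_fract ` nodal_lattice f h)"
  using orbit_full_inject[OF submodule_order order_full submodule_lattice lattice_full[OF assms]]
    order_neq_lattice[OF f_nonunit] by (rule contrapos_nn[rotated])

lemma Jac_representation:
  assumes "D \<in> carrier (Jac f)"
  shows "D \<noteq> \<one>\<^bsub>Jac f\<^esub> \<Longrightarrow>
      \<exists>!h. degree_below h (Polynomial.degree f) \<and> coprime f ([:0, 1:] - h ^ 2) \<and> represents f h D"
    and "D = \<one>\<^bsub>Jac f\<^esub> \<Longrightarrow> mumford_represents f 1 0 D"
    and "D = \<one>\<^bsub>Jac f\<^esub> \<Longrightarrow> degree_below h (Polynomial.degree f) \<Longrightarrow>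
      coprime f ([:0, 1:] - h ^ 2) \<Longrightarrow> \<not> represents f h D"
proof -
  \<comment> \<open>For these h the Mumford conditions hold, so representing D is an equality of
    orbits.\<close>
  have rep: "represents f h D \<longleftrightarrow> D = M.orbit (to_fract ` nodal_lattice f h)"
    if "degree_below h (Polynomial.degree f)" "coprime f ([:0, 1:] - h ^ 2)" for h
    using mumford_pair_lattice[OF f_nonzero that]
    by (auto simp: represents_def mumford_represents_def mumford_class_lattice)
  show "\<exists>!h. degree_below h (Polynomial.degree f) \<and> coprime f ([:0, 1:] - h ^ 2) \<and> represents f h D"
    if neq: "D \<noteq> \<one>\<^bsub>Jac f\<^esub>"
  proof -
    obtain h where h: "degree_below h (Polynomial.degree f)" "coprime f ([:0, 1:] - h ^ 2)"
        "D = M.orbit (to_fract ` nodal_lattice f h)"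
      using Jac_classification[OF assms] neq by (auto simp: Jac_one)
    show ?thesis
    proof (rule ex1I[of _ h])
      show "degree_below h (Polynomial.degree f) \<and> coprime f ([:0, 1:] - h ^ 2) \<and> represents f h D"
        using h rep by blast
      fix k assume k: "degree_below k (Polynomial.degree f) \<and> coprime f ([:0, 1:] - k ^ 2) \<and> represents f k D"
      then have "M.orbit (to_fract ` nodal_lattice f k) = M.orbit (to_fract ` nodal_lattice f h)"
        using rep h(3) by metis
      then have "nodal_lattice f k = nodal_lattice f h"
        using k h(2) by (intro orbit_lattice_inject) auto
      then show "k = h" using k h(1) lattice_inject by blast
    qed
  qed
  show "mumford_represents f 1 0 D" if "D = \<one>\<^bsub>Jac f\<^esub>"
    using that by (auto simp: mumford_represents_def mumford_class_one Jac_one mumford_pair_def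
        degree_below_def simp flip: poly_eq_0_iff_dvd)
  show "\<not> represents f h D" if "D = \<one>\<^bsub>Jac f\<^esub>" "degree_below h (Polynomial.degree f)"
      "coprime f ([:0, 1:] - h ^ 2)"
    using that rep orbit_order_neq_lattice by (metis Jac_one)
qed

end

text \<open>The identity is set apart because its module is the order itself, the line of 1, which
  is not spanned by any t - h; its representative is [1, 0].\<close>

theorem theorem1p2:
  fixes f :: "'a::{field,finite} poly" and d :: nat
  assumes "CHAR('a) \<noteq> 2"
    and "Factorial_Ring.irreducible f"
    and "Polynomial.degree f = d"
    and "D \<in> carrier (Jac f)"
  shows "(D \<noteq> \<one>\<^bsub>Jac f\<^esub> \<longrightarrow>
            (\<exists>!h. degree_below h d \<and> coprime f ([:0, 1:] - h ^ 2) \<and> represents f h D)) \<and>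
         (D = \<one>\<^bsub>Jac f\<^esub> \<longrightarrow>
            mumford_represents f 1 0 D \<and>
            \<not> (\<exists>h. degree_below h d \<and> coprime f ([:0, 1:] - h ^ 2) \<and> represents f h D))"
  using Jac_representation[OF assms(2,4)] unfolding assms(3) by blast

end
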